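(* Let $n\ge1$, let $\omega\in L^1_{\mathcal F}(\mathbb R)$ be the weight of a P\'olya ensemble on $H_2=\mathrm{Herm}(n)$, and let $x=(x_1,\ldots,x_n)\in\mathbb R^n$ have pairwise distinct entries. Consider the joint probability density $$p_D(y|x)=\frac{1}{n!(\mathcal F\omega(0))^n}\frac{\Delta_n(y)}{\Delta_n(x)}\det[\omega(y_a-x_b)]_{a,b=1,\ldots,n},\qquad y\in\mathbb R^n,$$ of the eigenvalues $y$ of $Y=X_1+X_2$, where $X_1\in H_2$ is drawn from the P\'olya ensemble associated to $\omega$ and $X_2\in H_2$ is a fixed matrix with eigenvalues $x$. This density can be described by the bi-orthonormal functions $\{p_j,q_j\}_{j=0,\ldots,n-1}$ on $\mathbb R$ given by $$p_j(y')=\int_0^\infty dr\,e^{-r}\left.\frac{(r-\imath\partial_t\partial_{y'})^{n-1}}{(n-1)!}\left(\prod_{l\ne j+1}\frac{x_l-y'}{x_l-x_{j+1}}\right)\frac{1}{\mathcal F\omega(t)}\right|_{t=0},\qquad q_j(y)=\omega(y-x_{j+1}),$$ and its kernel is $$K_n(y',y)=\int_0^\infty dr\,e^{-r}\left.\frac{(r-\imath\partial_t\partial_{y'})^{n-1}}{(n-1)!}\left(\sum_{j=1}^n\omega(y-x_j)\prod_{l\ne j}\frac{x_l-y'}{x_l-x_j}\right)\frac{1}{\mathcal F\omega(t)}\right|_{t=0}.$$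
   Context: Notation: $\imath=\sqrt{-1}$; $\Delta_n(x)=\prod_{1\le b<c\le n}(x_c-x_b)$; $\mathcal F f(s)=\int_{-\infty}^\infty f(x)e^{\imath xs}dx$. Products over $l\neq j$ run over $l\in\{1,\ldots,n\}\setminus\{j\}$. $L^1_{\mathcal F}(\mathbb R)$ is the set of $f\in L^1(\mathbb R)$ that are non-negative, $(n-1)$-times differentiable and satisfy $\int_{-\infty}^\infty |x^{\kappa-1}f^{(j)}(x)|dx<\infty$ for all $\kappa\in[1,n]$ and $j=0,\ldots,n-1$. P\'olya ensemble on $H_2$: a random Hermitian $n\times n$ matrix whose law has a density (with respect to Lebesgue measure) invariant under conjugation by $\mathrm U(n)$, and whose unordered eigenvalues have joint probability density on $\mathbb R^n$ proportional to $\Delta_n(x)\det[w_b(x_c)]_{b,c=1}^n\ge 0$ with $w_j=(-\partial_x)^{j-1}\omega$, $\omega\in L^1_{\mathcal F}(\mathbb R)$; $\omega$ is called the associated weight. Description by bi-orthonormal functions: a density proportional to $\Delta_n(y)\det[w_b(y_c)]$ on $\mathbb R^n$ is described by $\{p_j,q_j\}_{j=0,\ldots,n-1}$ if $\int_{\mathbb R}p_l(y)q_m(y)dy=\delta_{lm}$ for $l,m=0,\ldots,n-1$, the linear span of $\{p_j\}$ equals that of $\{y^j\}_{j=0,\ldots,n-1}$, and the linear span of $\{q_j\}$ equals that of $\{w_{j+1}\}_{j=0,\ldots,n-1}$ (here $w_b=\omega(\cdot-x_b)$). The corresponding kernel is $K_n(y',y)=\sum_{j=0}^{n-1}p_j(y')q_j(y)$.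 In the formulas, $\partial_t$ acts on $1/\mathcal F\omega(t)$ and $\partial_{y'}$ acts on the polynomial in $y'$. *)

theory Defs
  imports
    "HOL-Probability.Probability"
    "HOL-Combinatorics.Permutations"
    "Jordan_Normal_Form.Schur_Decomposition"
begin

text \<open>
  Vectors in \<open>\<real>\<^sup>n\<close> are functions \<open>nat \<Rightarrow> real\<close> of which only the entries with index in
  \<open>{1..n}\<close> matter; Lebesgue measure on \<open>\<real>\<^sup>n\<close> is the product measure below.
\<close>

abbreviation lebesgue_vec :: "nat \<Rightarrow> (nat \<Rightarrow> real) measure" where
  "lebesgue_vec n \<equiv> PiM {1..n} (\<lambda>_. lborel)"

definition vandermonde :: "nat \<Rightarrow> (nat \<Rightarrow> real) \<Rightarrow> real" where
  "vandermonde n x = (\<Prod>c\<in>{1..n}. \<Prod>b\<in>{1..<c}. x c - x b)"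

text \<open>The determinant \<open>det [F a b]\<close> with \<open>a, b = 1, \<dots>, n\<close>; entries of \<^const>\<open>Matrix.mat\<close> count from 0.\<close>

definition det_1n :: "nat \<Rightarrow> (nat \<Rightarrow> nat \<Rightarrow> real) \<Rightarrow> real" where
  "det_1n n F = Determinant.det (Matrix.mat n n (\<lambda>(a, b). F (Suc a) (Suc b)))"


subsection \<open>Hermitian random matrices\<close>

definition Herm :: "nat \<Rightarrow> complex Matrix.mat set" where
  "Herm n = {A \<in> carrier_mat n n. mat_adjoint A = A}"

definition unitary_group :: "nat \<Rightarrow> complex Matrix.mat set" where
  "unitary_group n = {U \<in> carrier_mat n n. mat_adjoint U * U = 1\<^sub>m n}"

text \<open>
  The \<open>n\<^sup>2\<close> real coordinates on the Hermitian matrices: diagonal entries, and real parts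
  (stored above the diagonal) and imaginary parts (stored below it) of the off-diagonal ones.
\<close>

definition herm_of_coords :: "nat \<Rightarrow> (nat \<times> nat \<Rightarrow> real) \<Rightarrow> complex Matrix.mat" where
  "herm_of_coords n h = Matrix.mat n n (\<lambda>(a, b).
     if a = b then complex_of_real (h (a, a))
     else if a < b then Complex (h (a, b)) (h (b, a))
     else Complex (h (b, a)) (- h (a, b)))"

definition lebesgue_herm :: "nat \<Rightarrow> complex Matrix.mat measure" where
  "lebesgue_herm n = embed_measure (PiM ({..<n} \<times> {..<n}) (\<lambda>_. lborel)) (herm_of_coords n)"

lemma inj_on_herm_of_coords:
  "inj_on (herm_of_coords n) (space (PiM ({..<n} \<times> {..<n}) (\<lambda>_. lborel)))"
proof (rule inj_onI)
  fix g h assume g: "g \<in> space (PiM ({..<n} \<times> {..<n}) (\<lambda>_. lborel :: real measure))"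
    and h: "h \<in> space (PiM ({..<n} \<times> {..<n}) (\<lambda>_. lborel :: real measure))"
    and eq: "herm_of_coords n g = herm_of_coords n h"
  show "g = h"
  proof (rule PiE_ext[where k = "{..<n} \<times> {..<n}" and s = "\<lambda>_. UNIV"])
    show "g \<in> ({..<n} \<times> {..<n}) \<rightarrow>\<^sub>E UNIV" "h \<in> ({..<n} \<times> {..<n}) \<rightarrow>\<^sub>E UNIV"
      using g h by (auto simp: space_PiM)
    fix i :: "nat \<times> nat" assume "i \<in> {..<n} \<times> {..<n}"
    then obtain a b where i: "i = (a, b)" "a < n" "b < n" by auto
    have "herm_of_coords n g $$ (a, b) = herm_of_coords n h $$ (a, b)"
      "herm_of_coords n g $$ (b, a) = herm_of_coords n h $$ (b, a)" using eq by simp_all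
    then show "g i = h i" using i
      by (auto simp: herm_of_coords_def split: if_splits)
  qed
qed

lemma space_lebesgue_herm: "space (lebesgue_herm n) = Herm n"
proof -
  have adj: "mat_adjoint A $$ (a, b) = cnj (A $$ (b, a))"
    if "A \<in> carrier_mat n n" "a < n" "b < n" for A :: "complex Matrix.mat" and a b
    using that by (simp add: mat_adjoint_def mat_of_rows_def)
  have dim: "mat_adjoint A \<in> carrier_mat n n"
    if "A \<in> carrier_mat n n" for A :: "complex Matrix.mat"
    using that by (auto simp: mat_adjoint_def)
  have "herm_of_coords n h \<in> Herm n" for h
  proof -
    have c: "herm_of_coords n h \<in> carrier_mat n n" by (simp add: herm_of_coords_def)
    have "mat_adjoint (herm_of_coords n h) = herm_of_coords n h"
    proof (rule eq_matI)
      fix a b assume "a < dim_row (herm_of_coords n h)" "b < dim_col (herm_of_coords n h)"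
      then have ab: "a < n" "b < n" using c by auto
      show "mat_adjoint (herm_of_coords n h) $$ (a, b) = herm_of_coords n h $$ (a, b)"
        using ab unfolding adj[OF c ab] by (auto simp: herm_of_coords_def complex_eq_iff)
    qed (use c dim[OF c] in auto)
    with c show ?thesis by (simp add: Herm_def)
  qed
  moreover have "A \<in> herm_of_coords n ` space (PiM ({..<n} \<times> {..<n}) (\<lambda>_. lborel))"
    if "A \<in> Herm n" for A
  proof
    have c: "A \<in> carrier_mat n n" and s: "mat_adjoint A = A" using that by (auto simp: Herm_def)
    define h where "h = restrict (\<lambda>(a, b). if a \<le> b then Re (A $$ (a, b)) else Im (A $$ (b, a)))
      ({..<n} \<times> {..<n})"
    show "h \<in> space (PiM ({..<n} \<times> {..<n}) (\<lambda>_. lborel))" by (auto simp: h_def space_PiM)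
    show "A = herm_of_coords n h"
    proof (rule eq_matI)
      fix a b assume "a < dim_row (herm_of_coords n h)" "b < dim_col (herm_of_coords n h)"
      then have ab: "a < n" "b < n" by (auto simp: herm_of_coords_def)
      have "A $$ (a, b) = cnj (A $$ (b, a))" using adj[OF c ab] s by simp
      then show "A $$ (a, b) = herm_of_coords n h $$ (a, b)"
        using ab by (auto simp: herm_of_coords_def h_def complex_eq_iff)
    qed (use c in \<open>auto simp: herm_of_coords_def\<close>)
  qed
  ultimately show ?thesis by (auto simp: lebesgue_herm_def space_embed_measure)
qed

definition has_eigenvalues :: "nat \<Rightarrow> complex Matrix.mat \<Rightarrow> (nat \<Rightarrow> real) \<Rightarrow> bool" where
  "has_eigenvalues n A x \<longleftrightarrow> char_poly A = (\<Prod>j\<in>{1..n}. [:- complex_of_real (x j), 1:])"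

text \<open>
  \<open>\<rho>\<close> is the joint density of the unordered eigenvalues of the random matrix \<open>X\<close>: it is symmetric,
  and it gives the probability that the eigenvalues of \<open>X\<close>, listed in any order, form a vector
  in \<open>B\<close>, for every permutation invariant Borel set \<open>B \<subseteq> \<real>\<^sup>n\<close>.
\<close>

definition unordered_eigenvalue_density ::
  "nat \<Rightarrow> 'a measure \<Rightarrow> ('a \<Rightarrow> complex Matrix.mat) \<Rightarrow> ((nat \<Rightarrow> real) \<Rightarrow> real) \<Rightarrow> bool" where
  "unordered_eigenvalue_density n M X \<rho> \<longleftrightarrow>
     \<rho> \<in> borel_measurable (lebesgue_vec n) \<and>
     (AE y in lebesgue_vec n. 0 \<le> \<rho> y) \<and>
     (\<forall>y \<sigma>. \<sigma> permutes {1..n} \<longrightarrow> \<rho> (y \<circ> \<sigma>) = \<rho> y) \<and>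
     (\<forall>B\<in>sets (lebesgue_vec n). (\<forall>y\<in>B. \<forall>\<sigma>. \<sigma> permutes {1..n} \<longrightarrow> y \<circ> \<sigma> \<in> B) \<longrightarrow>
        emeasure M {m \<in> space M. \<exists>y\<in>B. has_eigenvalues n (X m) y} =
        emeasure (density (lebesgue_vec n) (\<lambda>y. ennreal (\<rho> y))) B)"


subsection \<open>Polya ensembles\<close>

definition fourier :: "(real \<Rightarrow> real) \<Rightarrow> real \<Rightarrow> complex" where
  "fourier f s = (LINT x|lborel. complex_of_real (f x) * exp (\<i> * complex_of_real (x * s)))"

definition L1F :: "nat \<Rightarrow> (real \<Rightarrow> real) set" where
  "L1F n = {f. integrable lborel f \<and> (\<forall>x. 0 \<le> f x) \<and>
     (\<forall>j<n - 1. \<forall>x. (deriv ^^ j) f differentiable at x) \<and>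
     (\<forall>\<kappa>\<in>{1..real n}. \<forall>j<n. integrable lborel (\<lambda>x. \<bar>x\<bar> powr (\<kappa> - 1) * \<bar>(deriv ^^ j) f x\<bar>))}"

definition polya_fun :: "(real \<Rightarrow> real) \<Rightarrow> nat \<Rightarrow> real \<Rightarrow> real" where
  "polya_fun \<omega> j = ((\<lambda>f x. - deriv f x) ^^ (j - 1)) \<omega>"

text \<open>The random matrix \<open>X\<close> on the probability space \<open>M\<close> is a Polya ensemble with weight \<open>\<omega>\<close>.\<close>

definition polya_ensemble ::
  "nat \<Rightarrow> (real \<Rightarrow> real) \<Rightarrow> 'a measure \<Rightarrow> ('a \<Rightarrow> complex Matrix.mat) \<Rightarrow> bool" where
  "polya_ensemble n \<omega> M X \<longleftrightarrow>
     prob_space M \<and> \<omega> \<in> L1F n \<and>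
     (\<exists>f. distributed M (lebesgue_herm n) X f \<and>
        (\<forall>U\<in>unitary_group n. \<forall>A\<in>Herm n. f (U * A * mat_adjoint U) = f A)) \<and>
     (\<forall>y. 0 \<le> vandermonde n y * det_1n n (\<lambda>b c. polya_fun \<omega> b (y c))) \<and>
     (\<exists>C>0. unordered_eigenvalue_density n M X
        (\<lambda>y. C * (vandermonde n y * det_1n n (\<lambda>b c. polya_fun \<omega> b (y c)))))"


subsection \<open>Bi-orthonormal functions\<close>

definition fun_span :: "nat \<Rightarrow> (nat \<Rightarrow> real \<Rightarrow> complex) \<Rightarrow> (real \<Rightarrow> complex) set" where
  "fun_span n f = {g. \<exists>c :: nat \<Rightarrow> complex. g = (\<lambda>y. \<Sum>j<n. c j * f j y)}"

text \<open>
  The density \<open>\<rho>\<close>, proportional to \<open>\<Delta>\<^sub>n(y) det [w\<^sub>b(y\<^sub>c)]\<close>, is described by the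
  functions \<open>p\<^sub>j, q\<^sub>j\<close>, \<open>j = 0, \<dots>, n - 1\<close>.
\<close>

definition described_by ::
  "nat \<Rightarrow> ((nat \<Rightarrow> real) \<Rightarrow> real) \<Rightarrow> (nat \<Rightarrow> real \<Rightarrow> real) \<Rightarrow>
     (nat \<Rightarrow> real \<Rightarrow> complex) \<Rightarrow> (nat \<Rightarrow> real \<Rightarrow> complex) \<Rightarrow> bool" where
  "described_by n \<rho> w p q \<longleftrightarrow>
     (\<exists>C. C \<noteq> 0 \<and> (\<forall>y. \<rho> y = C * (vandermonde n y * det_1n n (\<lambda>b c. w b (y c))))) \<and>
     (\<forall>l<n. \<forall>m<n. has_bochner_integral lborel (\<lambda>y. p l y * q m y) (if l = m then 1 else 0)) \<and>
     fun_span n p = fun_span n (\<lambda>j y. complex_of_real (y ^ j)) \<and>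
     fun_span n q = fun_span n (\<lambda>j y. complex_of_real (w (j + 1) y))"

definition biorth_kernel :: "nat \<Rightarrow> (nat \<Rightarrow> real \<Rightarrow> complex) \<Rightarrow> (nat \<Rightarrow> real \<Rightarrow> complex) \<Rightarrow>
    real \<Rightarrow> real \<Rightarrow> complex" where
  "biorth_kernel n p q y' y = (\<Sum>j<n. p j y' * q j y)"


subsection \<open>Sum of a Polya ensemble and a fixed matrix\<close>

text \<open>The value \<open>fourier \<omega> 0\<close> is the real number \<open>\<integral>\<omega>\<close>.\<close>

definition p_D :: "nat \<Rightarrow> (real \<Rightarrow> real) \<Rightarrow> (nat \<Rightarrow> real) \<Rightarrow> (nat \<Rightarrow> real) \<Rightarrow> real" where
  "p_D n \<omega> x y = 1 / (fact n * Re (fourier \<omega> 0) ^ n) * (vandermonde n y / vandermonde n x)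
     * det_1n n (\<lambda>a b. \<omega> (y a - x b))"

text \<open>The operator \<open>r - \<i> \<partial>\<^sub>t \<partial>\<^sub>u\<close> on functions \<open>g t u\<close>.\<close>

definition mixed_op :: "real \<Rightarrow> (real \<Rightarrow> real \<Rightarrow> complex) \<Rightarrow> real \<Rightarrow> real \<Rightarrow> complex" where
  "mixed_op r g = (\<lambda>t u. complex_of_real r * g t u
     - \<i> * vector_derivative (\<lambda>t'. vector_derivative (\<lambda>u'. g t' u') (at u)) (at t))"

text \<open>
  The common shape of the formulas for \<open>p\<^sub>j\<close> and for the kernel: \<open>P\<close> is the polynomial in \<open>y'\<close>
  to which \<open>\<partial>\<^sub>y\<^sub>'\<close> is applied.
\<close>

definition laplace_op :: "nat \<Rightarrow> (real \<Rightarrow> real) \<Rightarrow> (real \<Rightarrow> real) \<Rightarrow> real \<Rightarrow> complex" where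
  "laplace_op n \<omega> P y' = (LINT r:{0..}|lborel. complex_of_real (exp (- r)) *
     ((mixed_op r ^^ (n - 1)) (\<lambda>t u. complex_of_real (P u) * (1 / fourier \<omega> t)) 0 y'
       / fact (n - 1)))"

definition p_fun :: "nat \<Rightarrow> (real \<Rightarrow> real) \<Rightarrow> (nat \<Rightarrow> real) \<Rightarrow> nat \<Rightarrow> real \<Rightarrow> complex" where
  "p_fun n \<omega> x j = laplace_op n \<omega> (\<lambda>u. \<Prod>l\<in>{1..n} - {j + 1}. (x l - u) / (x l - x (j + 1)))"

definition q_fun :: "(real \<Rightarrow> real) \<Rightarrow> (nat \<Rightarrow> real) \<Rightarrow> nat \<Rightarrow> real \<Rightarrow> complex" where
  "q_fun \<omega> x j y = complex_of_real (\<omega> (y - x (j + 1)))"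

end

theory Submission
  imports Defs
begin

text \<open>
  Put \<open>a\<^sub>k(t) = \<integral> x\<^sup>k e\<^sup>i\<^sup>x\<^sup>t \<omega>(x) dx / k!\<close> and let \<open>b(t)\<close> be the reciprocal of the formal power series
  \<open>a(t) = \<Sum>\<^sub>k a\<^sub>k(t) z\<^sup>k\<close>. For a power series \<open>c\<close> write \<open>c(D)\<close> for the operator \<open>\<Sum>\<^sub>k c\<^sub>k d\<^sup>k/dy\<^sup>k\<close> on
  polynomials of degree less than \<open>n\<close>, for which only the terms with \<open>k < n\<close> count.
  Substituting \<open>z = D\<close> respects products, so \<open>a(0)(D)\<close> and \<open>b(0)(D)\<close> are inverse to each other
  (\<open>diff_op_mult\<close>). Everything follows from two descriptions of these operators.

  The first concerns \<open>a\<close>: by Taylor's formula, \<open>\<integral> Q(y) \<omega>(y - s) dy = (a(0)(D) Q)(s)\<close>, so that integrating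
  against \<open>q\<^sub>m\<close> evaluates \<open>a(0)(D) Q\<close> at the node \<open>x\<^sub>m\<^sub>+\<^sub>1\<close> (\<open>has_bochner_integral_poly_shift\<close>).

  The second concerns \<open>b\<close>: since \<open>a\<^sub>k' = \<i> (k + 1) a\<^sub>k\<^sub>+\<^sub>1\<close>, the reciprocal satisfies the same relation
  \<open>b\<^sub>k' = \<i> (k + 1) b\<^sub>k\<^sub>+\<^sub>1\<close> (\<open>fps_inverse_tower\<close>). Hence each application of \<open>- \<i> \<partial>\<^sub>t\<close> to
  \<open>b\<^sub>0 = 1 / \<F>\<omega>\<close> moves one step up in the series, the binomial theorem expands
  \<open>(r - \<i> \<partial>\<^sub>t \<partial>\<^sub>u)\<^sup>n\<^sup>-\<^sup>1 (P(u) b\<^sub>0(t))\<close>, and the integrals \<open>\<integral> r\<^sup>k e\<^sup>-\<^sup>r dr = k!\<close> turn the binomial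
  coefficients into \<open>1\<close>. The Laplace integral of the theorem is therefore \<open>(b(0)(D) P)(y')\<close>
  (\<open>laplace_op_poly\<close>).

  Thus \<open>p\<^sub>j = b(0)(D) \<ell>\<^sub>j\<^sub>+\<^sub>1\<close> for the Lagrange basis polynomials \<open>\<ell>\<^sub>j\<close> of the nodes \<open>x\<close>.
  Bi-orthogonality is \<open>(a(0)(D) b(0)(D) \<ell>\<^sub>l)(x\<^sub>m) = \<ell>\<^sub>l(x\<^sub>m) = \<delta>\<^sub>l\<^sub>m\<close>. The \<open>p\<^sub>j\<close> span the polynomials of
  degree less than \<open>n\<close>, because \<open>W = b(0)(D) (a(0)(D) W)\<close> and \<open>a(0)(D) W\<close> is a combination of the
  \<open>\<ell>\<^sub>j\<close> by Lagrange interpolation. The kernel formula is the linearity of \<open>b(0)(D)\<close>.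

  The reciprocal exists because \<open>\<F>\<omega>(0) \<noteq> 0\<close>: otherwise the density of the eigenvalues of
  \<open>X\<^sub>1 + X\<^sub>2\<close> would be zero (its constant \<open>1 / \<F>\<omega>(0)\<^sup>n\<close> having the value \<open>1 / 0 = 0\<close>), whereas
  a Hermitian matrix always has real eigenvalues, which makes the total mass \<open>1\<close>
  (\<open>not_unordered_eigenvalue_density_zero\<close>).
\<close>

section \<open>Real eigenvalues of Hermitian matrices\<close>

lemma mat_adjoint_index:
  fixes A :: "complex Matrix.mat"
  assumes "A \<in> carrier_mat n n" "a < n" "b < n"
  shows "mat_adjoint A $$ (a, b) = cnj (A $$ (b, a))"
  using assms by (simp add: mat_adjoint_def mat_of_rows_def)

lemma Herm_iff:
  "A \<in> Herm n \<longleftrightarrow> A \<in> carrier_mat n n \<and> (\<forall>a<n. \<forall>b<n. cnj (A $$ (b, a)) = A $$ (a, b))"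
proof (cases "A \<in> carrier_mat n n")
  case True
  have dim: "mat_adjoint A \<in> carrier_mat n n"
    using True by (auto simp: mat_adjoint_def)
  have "mat_adjoint A = A \<longleftrightarrow> (\<forall>a<n. \<forall>b<n. mat_adjoint A $$ (a, b) = A $$ (a, b))"
    using True dim by (auto intro!: eq_matI)
  then show ?thesis using True by (simp add: Herm_def mat_adjoint_index)
qed (simp add: Herm_def)

lemma Herm_add:
  assumes "A \<in> Herm n" "B \<in> Herm n"
  shows "A + B \<in> Herm n"
  using assms unfolding Herm_iff by auto

text \<open>
  Pairing \<open>A v = k v\<close> with the conjugate of \<open>v\<close>, and moving \<open>A\<close> to the other side, gives
  \<open>k \<parallel>v\<parallel>\<^sup>2 = cnj k \<parallel>v\<parallel>\<^sup>2\<close>.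
\<close>

lemma Herm_eigenvalue_real:
  assumes A: "A \<in> Herm n" and "eigenvalue A k"
  shows "cnj k = k"
proof -
  have c: "A \<in> carrier_mat n n" using A by (simp add: Herm_def)
  obtain v where v: "v \<in> carrier_vec n" "v \<noteq> 0\<^sub>v n" "A *\<^sub>v v = k \<cdot>\<^sub>v v"
    using assms(2) c by (auto simp: eigenvalue_def eigenvector_def)
  have tr: "transpose_mat A *\<^sub>v conjugate v = cnj k \<cdot>\<^sub>v conjugate v"
  proof (rule eq_vecI)
    fix i assume "i < dim_vec (cnj k \<cdot>\<^sub>v conjugate v)"
    then have i: "i < n" using v by simp
    have "vec_index (transpose_mat A *\<^sub>v conjugate v) i = (\<Sum>j<n. A $$ (j, i) * cnj (vec_index v j))"
      using i c v by (simp add: scalar_prod_def atLeast0LessThan)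
    also have "\<dots> = (\<Sum>j<n. cnj (A $$ (i, j) * vec_index v j))"
    proof (intro sum.cong refl)
      fix j assume "j \<in> {..<n}"
      then have "cnj (A $$ (i, j)) = A $$ (j, i)" using A i unfolding Herm_iff by blast
      then show "A $$ (j, i) * cnj (vec_index v j) = cnj (A $$ (i, j) * vec_index v j)" by simp
    qed
    also have "\<dots> = cnj (\<Sum>j<n. A $$ (i, j) * vec_index v j)" by simp
    also have "(\<Sum>j<n. A $$ (i, j) * vec_index v j) = vec_index (A *\<^sub>v v) i"
      using i c v(1) by (simp add: scalar_prod_def atLeast0LessThan)
    also have "cnj \<dots> = vec_index (cnj k \<cdot>\<^sub>v conjugate v) i"
      unfolding v(3) using i v(1) by simp
    finally show "vec_index (transpose_mat A *\<^sub>v conjugate v) i = vec_index (cnj k \<cdot>\<^sub>v conjugate v) i" .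
  qed (use c v in auto)
  have "cnj k * (conjugate v \<bullet> v) = (transpose_mat A *\<^sub>v conjugate v) \<bullet> v"
    unfolding tr using v by simp
  also have "\<dots> = conjugate v \<bullet> (A *\<^sub>v v)"
    using v by (intro transpose_vec_mult_scalar[OF c]) auto
  also have "\<dots> = k * (conjugate v \<bullet> v)"
    unfolding v(3) using v by simp
  finally have "cnj k * (conjugate v \<bullet> v) = k * (conjugate v \<bullet> v)" .
  moreover have "conjugate v \<bullet> v \<noteq> 0"
    using v conjugate_vec_sprod_comm[OF v(1) v(1)] conjugate_square_eq_0_vec[OF v(1)] by simp
  ultimately show ?thesis by simp
qed

lemma Herm_has_eigenvalues:
  assumes A: "A \<in> Herm n"
  shows "\<exists>y\<in>space (lebesgue_vec n). has_eigenvalues n A y"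
proof -
  have c: "A \<in> carrier_mat n n" using A by (simp add: Herm_def)
  obtain as where as: "char_poly A = (\<Prod>a\<leftarrow>as. [:- a, 1:])" "length as = n"
    using char_poly_factorized[OF c] by auto
  have real: "complex_of_real (Re a) = a" if "a \<in> set as" for a
  proof -
    have "poly (char_poly A) a = 0"
      using that by (force simp: as(1) poly_prod_list prod_list_zero_iff image_iff)
    then have "eigenvalue A a" using eigenvalue_root_char_poly[OF c] by simp
    then have "cnj a = a" by (rule Herm_eigenvalue_real[OF A])
    then show ?thesis by (simp add: complex_eq_iff)
  qed
  define y where "y = restrict (\<lambda>j. Re (as ! (j - 1))) {1..n}"
  have "char_poly A = (\<Prod>i<n. [:- as ! i, 1:])"
    unfolding as(1) by (simp add: prod.list_conv_set_nth as(2) atLeast0LessThan)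
  also have "\<dots> = (\<Prod>j\<in>{1..n}. [:- as ! (j - 1), 1:])"
    by (rule prod.reindex_bij_witness[of _ "\<lambda>j. j - 1" Suc]) auto
  also have "\<dots> = (\<Prod>j\<in>{1..n}. [:- complex_of_real (y j), 1:])"
    by (intro prod.cong) (auto simp: y_def real as(2))
  finally have "has_eigenvalues n A y" by (simp add: has_eigenvalues_def)
  moreover have "y \<in> space (lebesgue_vec n)" by (simp add: y_def space_PiM)
  ultimately show ?thesis by blast
qed

text \<open>
  Testing the density on the whole space, which is permutation invariant: every point of \<open>M\<close> yields
  a vector of real eigenvalues, so this event has probability \<open>1\<close>.
\<close>

lemma not_unordered_eigenvalue_density_zero:
  assumes "prob_space M" and Herm: "\<And>m. m \<in> space M \<Longrightarrow> X m \<in> Herm n"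
  shows "\<not> unordered_eigenvalue_density n M X (\<lambda>_. 0)"
proof
  assume dens: "unordered_eigenvalue_density n M X (\<lambda>_. 0)"
  let ?B = "space (lebesgue_vec n)"
  have inv: "\<forall>y\<in>?B. \<forall>\<sigma>. \<sigma> permutes {1..n} \<longrightarrow> y \<circ> \<sigma> \<in> ?B"
    by (auto simp: space_PiM PiE_def extensional_def permutes_not_in)
  have "emeasure M {m \<in> space M. \<exists>y\<in>?B. has_eigenvalues n (X m) y} =
      emeasure (density (lebesgue_vec n) (\<lambda>y. ennreal 0)) ?B"
    using dens inv sets.top[of "lebesgue_vec n"]
    unfolding unordered_eigenvalue_density_def by blast
  also have "\<dots> = 0" by (simp add: emeasure_density)
  also have "{m \<in> space M. \<exists>y\<in>?B. has_eigenvalues n (X m) y} = space M"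
    using Herm Herm_has_eigenvalues by blast
  also have "emeasure M (space M) = 1" by (rule prob_space.emeasure_space_1[OF assms(1)])
  finally show False by simp
qed

section \<open>Constant coefficient operators on polynomials\<close>

text \<open>
  The power series \<open>c\<close> with differentiation substituted for its variable. Cutting the series at \<open>n\<close>
  loses nothing on polynomials of degree less than \<open>n\<close>, the only ones to which it is applied.
\<close>

definition diff_op :: "nat \<Rightarrow> complex fps \<Rightarrow> complex poly \<Rightarrow> complex poly" where
  "diff_op n c P = (\<Sum>j<n. Polynomial.smult (fps_nth c j) ((pderiv ^^ j) P))"

lemma higher_pderiv_eq_0:
  assumes "Polynomial.degree P < k"
  shows "(pderiv ^^ k) P = (0 :: complex poly)"
proof (rule poly_eqI)
  fix m
  have "coeff P (m + k) = 0" using assms by (intro coeff_eq_0) simp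
  then show "coeff ((pderiv ^^ k) P) m = coeff 0 m" by (simp add: coeff_higher_pderiv)
qed

text \<open>
  The cut at \<open>n\<close> turns the double sum for the composition into one over a square of indices. Its part
  above the antidiagonal contributes derivatives of order at least \<open>n\<close>, hence zero, and the
  remaining triangle is the Cauchy product.
\<close>

lemma diff_op_mult:
  assumes "Polynomial.degree P < n"
  shows "diff_op n a (diff_op n b P) = diff_op n (a * b) P"
proof -
  let ?g = "\<lambda>i j. Polynomial.smult (fps_nth a i * fps_nth b j) ((pderiv ^^ (i + j)) P)"
  have "diff_op n a (diff_op n b P) = (\<Sum>i<n. \<Sum>j<n. ?g i j)"
    by (simp add: diff_op_def higher_pderiv_sum higher_pderiv_smult smult_sum2 funpow_add)
  also have "\<dots> = (\<Sum>(i, j)\<in>{..<n} \<times> {..<n}. ?g i j)"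
    by (simp add: sum.cartesian_product)
  also have "\<dots> = (\<Sum>(i, j)\<in>{(i, j). i + j < n}. ?g i j)"
  proof (rule sum.mono_neutral_right)
    show "\<forall>p\<in>{..<n} \<times> {..<n} - {(i, j). i + j < n}. (case p of (i, j) \<Rightarrow> ?g i j) = 0"
      using assms by (auto intro!: higher_pderiv_eq_0)
  qed auto
  also have "\<dots> = (\<Sum>k<n. \<Sum>i\<le>k. ?g i (k - i))"
    by (rule sum.triangle_reindex)
  also have "\<dots> = diff_op n (a * b) P"
    by (simp add: diff_op_def fps_mult_nth atLeast0AtMost smult_sum)
  finally show ?thesis .
qed

lemma diff_op_one:
  assumes "n \<ge> 1"
  shows "diff_op n 1 P = P"
proof -
  have "diff_op n 1 P = (\<Sum>j<n. if j = 0 then P else 0)"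
    unfolding diff_op_def by (intro sum.cong) auto
  then show ?thesis using assms by simp
qed

lemma degree_diff_op: "Polynomial.degree (diff_op n c P) \<le> Polynomial.degree P"
  unfolding diff_op_def
proof (intro degree_sum_le)
  fix j
  have "Polynomial.degree (Polynomial.smult (fps_nth c j) ((pderiv ^^ j) P)) \<le>
      Polynomial.degree ((pderiv ^^ j) P)" by (rule degree_smult_le)
  also have "\<dots> \<le> Polynomial.degree P" by (simp add: degree_higher_pderiv)
  finally show "Polynomial.degree (Polynomial.smult (fps_nth c j) ((pderiv ^^ j) P)) \<le>
      Polynomial.degree P" .
qed simp

lemma diff_op_sum: "diff_op n c (\<Sum>i\<in>I. Polynomial.smult (a i) (P i)) =
    (\<Sum>i\<in>I. Polynomial.smult (a i) (diff_op n c (P i)))"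
  by (simp add: diff_op_def higher_pderiv_sum higher_pderiv_smult smult_sum2 sum.swap[of _ I]
      mult.commute)

text \<open>
  The coefficients of \<open>P(s + z)\<close>, as a polynomial in \<open>z\<close>, are its derivatives at \<open>z = 0\<close> divided by
  factorials, and differentiation commutes with the shift.
\<close>

lemma poly_taylor:
  fixes P :: "complex poly"
  assumes "Polynomial.degree P < n"
  shows "poly P (s + z) = (\<Sum>k<n. poly ((pderiv ^^ k) P) s / fact k * z ^ k)"
proof -
  define R where "R = pcompose P [:s, 1:]"
  have pd: "(pderiv ^^ k) R = pcompose ((pderiv ^^ k) P) [:s, 1:]" for k
    by (induction k) (simp_all add: R_def pderiv_pcompose pderiv_pCons)
  have c: "coeff R k = poly ((pderiv ^^ k) P) s / fact k" for k
  proof -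
    have "poly ((pderiv ^^ k) P) s = coeff ((pderiv ^^ k) R) 0"
      unfolding pd by (simp add: poly_pcompose flip: poly_0_coeff_0)
    then show ?thesis by (simp add: coeff_higher_pderiv flip: pochhammer_fact)
  qed
  have deg: "Polynomial.degree R < n" using assms by (simp add: R_def degree_pcompose)
  have "poly P (s + z) = poly R z" by (simp add: R_def poly_pcompose)
  also have "\<dots> = (\<Sum>k\<le>n - 1. coeff R k * z ^ k)"
    unfolding poly_altdef using deg
    by (intro sum.mono_neutral_left) (auto simp: coeff_eq_0)
  also have "{..n - 1} = {..<n}" using deg by auto
  finally show ?thesis by (simp add: c)
qed

section \<open>Lagrange interpolation and spans\<close>

definition lagrange_poly :: "nat \<Rightarrow> (nat \<Rightarrow> real) \<Rightarrow> nat \<Rightarrow> complex poly" where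
  "lagrange_poly n x j = (\<Prod>l\<in>{1..n} - {j}.
     Polynomial.smult (complex_of_real (1 / (x l - x j))) [:complex_of_real (x l), - 1:])"

lemma poly_lagrange_poly:
  "poly (lagrange_poly n x j) (complex_of_real u) =
    complex_of_real (\<Prod>l\<in>{1..n} - {j}. (x l - u) / (x l - x j))"
  unfolding lagrange_poly_def poly_prod of_real_prod
  by (intro prod.cong refl) (simp add: diff_divide_distrib)

lemma degree_lagrange_poly:
  assumes "j \<in> {1..n}"
  shows "Polynomial.degree (lagrange_poly n x j) < n"
proof -
  have "Polynomial.degree (lagrange_poly n x j) \<le> (\<Sum>l\<in>{1..n} - {j}. 1)"
    unfolding lagrange_poly_def
  proof (rule order_trans[OF degree_prod_sum_le sum_mono])
    show "(Polynomial.degree \<circ> (\<lambda>l. Polynomial.smult (complex_of_real (1 / (x l - x j)))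
        [:complex_of_real (x l), - 1:])) l \<le> 1" for l
      unfolding o_def by (rule order_trans[OF degree_smult_le]) simp
  qed simp
  also have "\<dots> < n" using assms by simp
  finally show ?thesis .
qed

lemma poly_lagrange_poly_node:
  assumes "inj_on x {1..n}" "j \<in> {1..n}" "m \<in> {1..n}"
  shows "poly (lagrange_poly n x j) (complex_of_real (x m)) = (if m = j then 1 else 0)"
proof (cases "m = j")
  case True
  have "x l - x j \<noteq> 0" if "l \<in> {1..n} - {j}" for l
    using assms that by (auto dest: inj_onD)
  then show ?thesis using True unfolding poly_lagrange_poly by simp
next
  case False
  then have "(\<Prod>l\<in>{1..n} - {j}. (x l - x m) / (x l - x j)) = 0"
    using assms(3) by (intro prod_zero) auto
  then show ?thesis using False unfolding poly_lagrange_poly by simp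
qed

text \<open>
  Both sides have degree less than \<open>n\<close> and agree at the \<open>n\<close> distinct nodes.
\<close>

lemma lagrange_interpolation:
  assumes inj: "inj_on x {1..n}" and deg: "Polynomial.degree Q < n"
  shows "Q = (\<Sum>j\<in>{1..n}. Polynomial.smult (poly Q (complex_of_real (x j))) (lagrange_poly n x j))"
    (is "Q = ?R")
proof -
  let ?A = "(\<lambda>j. complex_of_real (x j)) ` {1..n}"
  have "inj_on (\<lambda>j. complex_of_real (x j)) {1..n}"
    using inj unfolding inj_on_def of_real_eq_iff .
  then have card: "card ?A = n" by (simp add: card_image)
  have degR: "Polynomial.degree ?R < n"
    using deg by (intro degree_sum_less order_le_less_trans[OF degree_smult_le degree_lagrange_poly])
      auto
  have eval: "poly Q z = poly ?R z" if "z \<in> ?A" for z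
  proof -
    obtain m where m: "m \<in> {1..n}" "z = complex_of_real (x m)" using \<open>z \<in> ?A\<close> by blast
    have "poly ?R z = (\<Sum>j\<in>{1..n}. poly Q (complex_of_real (x j)) * (if m = j then 1 else 0))"
      unfolding poly_sum poly_smult m(2)
      by (intro sum.cong refl arg_cong2[where f="(*)"] poly_lagrange_poly_node inj m(1))
    also have "\<dots> = (\<Sum>j\<in>{1..n}. if m = j then poly Q (complex_of_real (x j)) else 0)"
      by (intro sum.cong) auto
    also have "\<dots> = poly Q z"
      using m by (simp only: sum.delta' finite_atLeastAtMost if_True)
    finally show ?thesis ..
  qed
  show ?thesis
    by (rule poly_eqI_degree[of ?A, OF eval]) (simp_all only: card deg degR)
qed

lemma fun_span_of_poly_basis:
  assumes deg: "\<And>j. j < n \<Longrightarrow> Polynomial.degree (R j) < n"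
    and p: "\<And>j y. j < n \<Longrightarrow> p j y = poly (R j) (complex_of_real y)"
    and gen: "\<And>W. Polynomial.degree W < n \<Longrightarrow> \<exists>c. W = (\<Sum>j<n. Polynomial.smult (c j) (R j))"
  shows "fun_span n p = fun_span n (\<lambda>j y. complex_of_real (y ^ j))"
proof
  show "fun_span n p \<subseteq> fun_span n (\<lambda>j y. complex_of_real (y ^ j))"
  proof
    fix g assume "g \<in> fun_span n p"
    then obtain c where g: "g = (\<lambda>y. \<Sum>j<n. c j * p j y)" by (auto simp: fun_span_def)
    have "p j y = (\<Sum>k<n. coeff (R j) k * complex_of_real y ^ k)" if "j < n" for j y
      unfolding p[OF that] poly_altdef using deg[OF that]
      by (intro sum.mono_neutral_left) (auto simp: coeff_eq_0)
    then have "g = (\<lambda>y. \<Sum>j<n. \<Sum>k<n. c j * coeff (R j) k * complex_of_real y ^ k)"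
      unfolding g by (simp add: sum_distrib_left mult.assoc)
    also have "\<dots> = (\<lambda>y. \<Sum>k<n. (\<Sum>j<n. c j * coeff (R j) k) * complex_of_real (y ^ k))"
      by (subst sum.swap) (simp add: sum_distrib_right)
    finally show "g \<in> fun_span n (\<lambda>j y. complex_of_real (y ^ j))"
      unfolding fun_span_def by (intro CollectI exI)
  qed
  show "fun_span n (\<lambda>j y. complex_of_real (y ^ j)) \<subseteq> fun_span n p"
  proof
    fix g assume "g \<in> fun_span n (\<lambda>j y. complex_of_real (y ^ j))"
    then obtain c where g: "g = (\<lambda>y. \<Sum>k<n. c k * complex_of_real (y ^ k))"
      by (auto simp: fun_span_def)
    show "g \<in> fun_span n p"
    proof (cases "n = 0")
      case True
      then show ?thesis using g by (simp add: fun_span_def)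
    next
      case False
      let ?W = "\<Sum>k<n. Polynomial.monom (c k) k"
      have "Polynomial.degree ?W < n"
        using False by (intro degree_sum_less) (auto intro: order_le_less_trans[OF degree_monom_le])
      then obtain d where d: "?W = (\<Sum>j<n. Polynomial.smult (d j) (R j))"
        using gen by blast
      have "g y = poly ?W (complex_of_real y)" for y
        by (simp add: g poly_sum poly_monom)
      then have "g = (\<lambda>y. \<Sum>j<n. d j * p j y)"
        unfolding d by (auto simp: poly_sum p)
      then show ?thesis unfolding fun_span_def by (intro CollectI exI)
    qed
  qed
qed

section \<open>Moments under the Fourier transform\<close>

text \<open>
  The membership condition with \<open>\<kappa> = k + 1\<close> and \<open>j = 0\<close> bounds \<open>\<bar>x\<bar>\<^sup>k \<omega>\<close> for \<open>k > 0\<close>; the case \<open>k = 0\<close>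
  is separate because \<open>0 powr 0 = 0\<close>.
\<close>

lemma L1F_moment_integrable:
  assumes "\<omega> \<in> L1F n" "k < n"
  shows "integrable lborel (\<lambda>x. x ^ k * \<omega> x)"
proof -
  have \<omega>: "integrable lborel \<omega>" "\<And>x. 0 \<le> \<omega> x"
    and mom: "\<And>\<kappa> j. \<kappa> \<in> {1..real n} \<Longrightarrow> j < n \<Longrightarrow>
      integrable lborel (\<lambda>x. \<bar>x\<bar> powr (\<kappa> - 1) * \<bar>(deriv ^^ j) \<omega> x\<bar>)"
    using assms(1) by (auto simp: L1F_def)
  show ?thesis
  proof (cases k)
    case 0
    then show ?thesis using \<omega> by simp
  next
    case (Suc m)
    have "integrable lborel (\<lambda>x. \<bar>x\<bar> powr real k * \<bar>\<omega> x\<bar>)"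
      using mom[of "real (k + 1)" 0] assms(2) by simp
    then show ?thesis
    proof (rule Bochner_Integration.integrable_bound)
      show "(\<lambda>x. x ^ k * \<omega> x) \<in> borel_measurable lborel"
        using borel_measurable_integrable[OF \<omega>(1)] by measurable
      show "AE x in lborel. norm (x ^ k * \<omega> x) \<le> norm (\<bar>x\<bar> powr real k * \<bar>\<omega> x\<bar>)"
        using Suc by (intro AE_I2) (auto simp: abs_mult power_abs powr_realpow' simp del: of_nat_Suc power_Suc)
    qed
  qed
qed

lemma has_vector_derivative_iff_quotient:
  "(f has_vector_derivative D) (at t) \<longleftrightarrow>
     ((\<lambda>s. (f s - f t) /\<^sub>R (s - t)) \<longlongrightarrow> D) (at t)"
proof -
  have eq: "norm (f s - f t - (s - t) *\<^sub>R D) / norm (s - t) = norm ((f s - f t) /\<^sub>R (s - t) - D)"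
    if "s \<noteq> t" for s
  proof -
    have "(f s - f t) /\<^sub>R (s - t) - D = (f s - f t - (s - t) *\<^sub>R D) /\<^sub>R (s - t)"
      using that by (simp add: scaleR_diff_right)
    then show ?thesis by (simp add: divide_inverse mult.commute)
  qed
  have "(f has_vector_derivative D) (at t) \<longleftrightarrow>
      ((\<lambda>s. norm (f s - f t - (s - t) *\<^sub>R D) / norm (s - t)) \<longlongrightarrow> 0) (at t)"
    by (simp add: has_vector_derivative_def has_derivative_iff_norm bounded_linear_scaleR_left)
  also have "\<dots> \<longleftrightarrow> ((\<lambda>s. norm ((f s - f t) /\<^sub>R (s - t) - D)) \<longlongrightarrow> 0) (at t)"
    by (rule filterlim_cong[OF refl refl], rule eventually_mono[OF eventually_neq_at_within eq])
  also have "\<dots> \<longleftrightarrow> ((\<lambda>s. (f s - f t) /\<^sub>R (s - t)) \<longlongrightarrow> D) (at t)"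
    by (simp only: tendsto_norm_zero_iff LIM_zero_iff)
  finally show ?thesis .
qed

definition fourier_moment :: "(real \<Rightarrow> real) \<Rightarrow> nat \<Rightarrow> real \<Rightarrow> complex" where
  "fourier_moment \<omega> k t =
     (LINT x|lborel. complex_of_real (x ^ k * \<omega> x) * exp (\<i> * complex_of_real (x * t)))"

lemma norm_iexp_diff_le: "cmod (exp (\<i> * complex_of_real a) - exp (\<i> * complex_of_real b)) \<le> \<bar>a - b\<bar>"
proof -
  have "exp (\<i> * complex_of_real a) - exp (\<i> * complex_of_real b) =
      exp (\<i> * complex_of_real b) * (exp (\<i> * complex_of_real (a - b)) - 1)"
    by (simp add: algebra_simps flip: exp_add)
  then have "cmod (exp (\<i> * complex_of_real a) - exp (\<i> * complex_of_real b)) =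
      2 * \<bar>sin ((a - b) / 2)\<bar>"
    by (simp only: norm_mult dist_exp_i_1) (simp add: norm_exp_i_times)
  also have "\<dots> \<le> \<bar>a - b\<bar>" using abs_sin_x_le_abs_x[of "(a - b) / 2"] by simp
  finally show ?thesis .
qed

lemma fourier_moment_integrable:
  assumes "integrable lborel (\<lambda>x. x ^ k * \<omega> x)"
  shows "integrable lborel (\<lambda>x. complex_of_real (x ^ k * \<omega> x) * exp (\<i> * complex_of_real (x * t)))"
  using assms
proof (rule Bochner_Integration.integrable_bound)
  show "(\<lambda>x. complex_of_real (x ^ k * \<omega> x) * exp (\<i> * complex_of_real (x * t)))
      \<in> borel_measurable lborel"
    using borel_measurable_integrable[OF assms] by measurable
qed (simp add: norm_mult norm_power abs_mult power_abs)

text \<open>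
  Differentiation under the integral sign. The difference quotients of \<open>t \<mapsto> e\<^sup>i\<^sup>x\<^sup>t\<close> are bounded by
  \<open>\<bar>x\<bar>\<close>, so those of the integrand are dominated by the next absolute moment density.
\<close>

lemma has_vector_derivative_fourier_moment:
  assumes ik: "integrable lborel (\<lambda>x. x ^ k * \<omega> x)"
    and iSk: "integrable lborel (\<lambda>x. x ^ Suc k * \<omega> x)"
  shows "(fourier_moment \<omega> k has_vector_derivative \<i> * fourier_moment \<omega> (Suc k) t) (at t)"
proof -
  let ?e = "\<lambda>x s. exp (\<i> * complex_of_real (x * s))"
  let ?f = "\<lambda>s x. complex_of_real (x ^ k * \<omega> x) * ?e x s"
  have "((\<lambda>s. (fourier_moment \<omega> k s - fourier_moment \<omega> k t) /\<^sub>R (s - t)) \<longlongrightarrow>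
      \<i> * fourier_moment \<omega> (Suc k) t) (at t)"
    unfolding tendsto_at_iff_sequentially
  proof (intro allI impI)
    fix X :: "nat \<Rightarrow> real" assume X: "\<forall>i. X i \<in> UNIV - {t}" "X \<longlonglongrightarrow> t"
    have "(\<lambda>i. LINT x|lborel. (?f (X i) x - ?f t x) /\<^sub>R (X i - t)) \<longlonglongrightarrow>
        (LINT x|lborel. \<i> * (complex_of_real (x ^ Suc k * \<omega> x) * ?e x t))"
    proof (rule integral_dominated_convergence)
      show "(\<lambda>x. \<i> * (complex_of_real (x ^ Suc k * \<omega> x) * ?e x t)) \<in> borel_measurable lborel"
        using borel_measurable_integrable[OF fourier_moment_integrable[OF iSk]] by measurable
      show "(\<lambda>x. (?f (X i) x - ?f t x) /\<^sub>R (X i - t)) \<in> borel_measurable lborel" for i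
        using borel_measurable_integrable[OF fourier_moment_integrable[OF ik]] by measurable
      show "integrable lborel (\<lambda>x. \<bar>x ^ Suc k * \<omega> x\<bar>)" using iSk by (rule integrable_abs)
      show "AE x in lborel. (\<lambda>i. (?f (X i) x - ?f t x) /\<^sub>R (X i - t)) \<longlonglongrightarrow>
          \<i> * (complex_of_real (x ^ Suc k * \<omega> x) * ?e x t)"
      proof (rule AE_I2)
        fix x
        have "((\<lambda>s. ?f s x) has_vector_derivative
            \<i> * (complex_of_real (x ^ Suc k * \<omega> x) * ?e x t)) (at t)"
          by (rule has_vector_derivative_real_field derivative_eq_intros refl | simp)+
        then have "((\<lambda>s. (?f s x - ?f t x) /\<^sub>R (s - t)) \<longlongrightarrow>
            \<i> * (complex_of_real (x ^ Suc k * \<omega> x) * ?e x t)) (at t)"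
          by (simp only: has_vector_derivative_iff_quotient)
        then show "(\<lambda>i. (?f (X i) x - ?f t x) /\<^sub>R (X i - t)) \<longlonglongrightarrow>
            \<i> * (complex_of_real (x ^ Suc k * \<omega> x) * ?e x t)"
          using X unfolding tendsto_at_iff_sequentially o_def by blast
      qed
      show "AE x in lborel. norm ((?f (X i) x - ?f t x) /\<^sub>R (X i - t)) \<le> \<bar>x ^ Suc k * \<omega> x\<bar>" for i
      proof (rule AE_I2)
        fix x
        have ne: "X i - t \<noteq> 0" using X by auto
        have "norm ((?f (X i) x - ?f t x) /\<^sub>R (X i - t)) =
            \<bar>x ^ k * \<omega> x\<bar> * norm (?e x (X i) - ?e x t) / \<bar>X i - t\<bar>"
          by (simp add: divide_inverse abs_mult norm_mult norm_power power_abs flip: right_diff_distrib)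
        also have "\<dots> \<le> \<bar>x ^ k * \<omega> x\<bar> * \<bar>x * X i - x * t\<bar> / \<bar>X i - t\<bar>"
          using norm_iexp_diff_le[of "x * X i" "x * t"]
          by (intro divide_right_mono mult_left_mono) auto
        also have "\<dots> = \<bar>x ^ Suc k * \<omega> x\<bar>"
          using ne by (simp add: abs_mult flip: right_diff_distrib)
        finally show "norm ((?f (X i) x - ?f t x) /\<^sub>R (X i - t)) \<le> \<bar>x ^ Suc k * \<omega> x\<bar>" .
      qed
    qed
    then show "((\<lambda>s. (fourier_moment \<omega> k s - fourier_moment \<omega> k t) /\<^sub>R (s - t)) \<circ> X) \<longlonglongrightarrow>
        \<i> * fourier_moment \<omega> (Suc k) t"
      using fourier_moment_integrable[OF ik] fourier_moment_integrable[OF iSk]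
      by (simp add: o_def fourier_moment_def del: of_real_mult of_real_power)
  qed
  then show ?thesis by (simp only: has_vector_derivative_iff_quotient)
qed

text \<open>
  The moment generating series of the complex measure \<open>e\<^sup>i\<^sup>x\<^sup>t \<omega>(x) dx\<close>. Dividing by \<open>k!\<close> and leaving out
  the powers of \<open>\<i>\<close> makes products of series compose differential operators and makes the
  coefficients at \<open>t = 0\<close> real.
\<close>

definition moment_fps :: "(real \<Rightarrow> real) \<Rightarrow> real \<Rightarrow> complex fps" where
  "moment_fps \<omega> t = Abs_fps (\<lambda>k. fourier_moment \<omega> k t / fact k)"

lemma moment_fps_0: "fps_nth (moment_fps \<omega> t) 0 = fourier \<omega> t"
  by (simp add: moment_fps_def fourier_moment_def fourier_def)

lemma has_vector_derivative_moment_fps: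
  assumes "\<omega> \<in> L1F n" "k < n - 1"
  shows "((\<lambda>t. fps_nth (moment_fps \<omega> t) k) has_vector_derivative
    \<i> * of_nat (k + 1) * fps_nth (moment_fps \<omega> t) (k + 1)) (at t)"
proof -
  have "((\<lambda>t. fourier_moment \<omega> k t / fact k) has_vector_derivative
      \<i> * fourier_moment \<omega> (Suc k) t / fact k) (at t)"
    using assms by (intro has_vector_derivative_divide has_vector_derivative_fourier_moment
        L1F_moment_integrable[of \<omega> n]) auto
  then show ?thesis by (simp add: moment_fps_def field_simps del: of_nat_Suc)
qed

text \<open>
  Substituting \<open>y = s + z\<close> and expanding \<open>Q(s + z)\<close> in powers of \<open>z\<close> leaves the moments of \<open>\<omega>\<close>.
\<close>

lemma has_bochner_integral_poly_shift:
  assumes \<omega>: "\<omega> \<in> L1F n" and deg: "Polynomial.degree Q < n"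
  shows "has_bochner_integral lborel (\<lambda>y. poly Q (complex_of_real y) * complex_of_real (\<omega> (y - s)))
    (poly (diff_op n (moment_fps \<omega> 0) Q) (complex_of_real s))"
proof -
  have moment: "has_bochner_integral lborel (\<lambda>z. complex_of_real (z ^ k * \<omega> z)) (fourier_moment \<omega> k 0)"
    if "k < n" for k
    unfolding has_bochner_integral_iff fourier_moment_def
    using L1F_moment_integrable[OF \<omega> that] by (simp del: of_real_mult of_real_power)
  have "has_bochner_integral lborel
      (\<lambda>z. \<Sum>k<n. (poly ((pderiv ^^ k) Q) s / fact k) * complex_of_real (z ^ k * \<omega> z))
      (\<Sum>k<n. (poly ((pderiv ^^ k) Q) s / fact k) * fourier_moment \<omega> k 0)"
    by (intro has_bochner_integral_sum has_bochner_integral_mult_right moment) simp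
  also have "(\<lambda>z. \<Sum>k<n. (poly ((pderiv ^^ k) Q) s / fact k) * complex_of_real (z ^ k * \<omega> z)) =
      (\<lambda>z. poly Q (complex_of_real (s + 1 * z)) * complex_of_real (\<omega> (s + 1 * z - s)))"
    by (simp add: poly_taylor[OF deg] sum_distrib_right mult.assoc)
  also have "(\<Sum>k<n. (poly ((pderiv ^^ k) Q) s / fact k) * fourier_moment \<omega> k 0) =
      poly (diff_op n (moment_fps \<omega> 0) Q) (complex_of_real s) /\<^sub>R \<bar>1\<bar>"
    by (simp add: diff_op_def poly_sum moment_fps_def mult.commute)
  finally show ?thesis
    by (subst lborel_has_bochner_integral_real_affine_iff[of 1 _ _ s]) simp_all
qed

section \<open>Derivatives of the reciprocal series\<close>

text \<open>
  Two derivations of power series are compared: \<open>d/dt\<close> on the coefficients, and \<open>c\<close> times the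
  formal derivative. They agree on \<open>A\<close> below order \<open>N\<close> and both send \<open>A * inverse A = 1\<close> to zero,
  hence they agree on \<open>inverse A\<close>. As only finitely many coefficients are
  known to be differentiable, the argument is an induction on \<open>k\<close>: the coefficient of order \<open>k\<close> of
  \<open>A * inverse A = 1\<close> expresses that of \<open>inverse A\<close> through earlier ones.
\<close>

lemma fps_inverse_tower:
  fixes A :: "real \<Rightarrow> complex fps"
  assumes "open S" and nz: "\<And>t. t \<in> S \<Longrightarrow> fps_nth (A t) 0 \<noteq> 0"
    and A: "\<And>k t. k < N \<Longrightarrow> t \<in> S \<Longrightarrow>
      ((\<lambda>t. fps_nth (A t) k) has_vector_derivative c * of_nat (k + 1) * fps_nth (A t) (k + 1)) (at t)"
    and "k < N" "t \<in> S"
  shows "((\<lambda>t. fps_nth (inverse (A t)) k) has_vector_derivative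
    c * of_nat (k + 1) * fps_nth (inverse (A t)) (k + 1)) (at t)"
  using \<open>k < N\<close>
proof (induction k rule: less_induct)
  case (less k)
  define B where "B t = inverse (A t)" for t
  have AB: "A t * B t = 1" if "t \<in> S" for t
    using nz[OF that] by (simp add: B_def inverse_mult_eq_1')
  have rec: "fps_nth (B u) k =
      (fps_nth 1 k - (\<Sum>i=1..k. fps_nth (A u) i * fps_nth (B u) (k - i))) / fps_nth (A u) 0"
    if "u \<in> S" for u
  proof -
    have "fps_nth 1 k = fps_nth (A u * B u) k" using AB[OF that] by simp
    also have "\<dots> = fps_nth (A u) 0 * fps_nth (B u) k +
        (\<Sum>i=1..k. fps_nth (A u) i * fps_nth (B u) (k - i))"
      unfolding fps_mult_nth by (subst sum.atLeast_Suc_atMost) simp_all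
    finally show ?thesis using nz[OF that] by (simp add: field_simps)
  qed
  define T where "T = (\<Sum>i=1..k.
      fps_nth (A t) i * (c * fps_nth (fps_deriv (B t)) (k - i)) +
      c * fps_nth (fps_deriv (A t)) i * fps_nth (B t) (k - i))"
  have dB: "((\<lambda>u. fps_nth (B u) i) has_vector_derivative c * fps_nth (fps_deriv (B t)) i) (at t)"
    if "i < k" for i
    using less.IH[OF that] less.prems that unfolding B_def by (simp add: mult.assoc)
  have dA: "((\<lambda>u. fps_nth (A u) i) has_vector_derivative c * fps_nth (fps_deriv (A t)) i) (at t)"
    if "i \<le> k" for i
    using A[of i t] that less.prems \<open>t \<in> S\<close> by (simp add: mult.assoc)
  have dsum: "((\<lambda>u. \<Sum>i=1..k. fps_nth (A u) i * fps_nth (B u) (k - i)) has_vector_derivative T) (at t)"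
    unfolding T_def by (intro has_vector_derivative_sum has_vector_derivative_mult dA dB) auto
  \<comment> \<open>The product rule for the formal derivative of \<open>A * B = 1\<close> evaluates \<open>T\<close>:
    only the summands with index \<open>0\<close> are missing from it.\<close>
  have "0 = c * fps_nth (fps_deriv (A t * B t)) k"
    by (simp add: AB[OF \<open>t \<in> S\<close>])
  also have "\<dots> = (\<Sum>i=0..k. fps_nth (A t) i * (c * fps_nth (fps_deriv (B t)) (k - i)) +
      c * fps_nth (fps_deriv (A t)) i * fps_nth (B t) (k - i))"
    unfolding fps_deriv_mult fps_add_nth fps_mult_nth
    by (simp add: sum_distrib_left sum.distrib distrib_left mult.left_commute mult.assoc
        del: fps_deriv_nth)
  also have "\<dots> = fps_nth (A t) 0 * (c * fps_nth (fps_deriv (B t)) k) +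
      c * fps_nth (fps_deriv (A t)) 0 * fps_nth (B t) k + T"
    unfolding T_def by (subst sum.atLeast_Suc_atMost) simp_all
  finally have T: "T = - (fps_nth (A t) 0 * (c * fps_nth (fps_deriv (B t)) k) +
      c * fps_nth (fps_deriv (A t)) 0 * fps_nth (B t) k)"
    by (simp only: eq_neg_iff_add_eq_0 add.commute)
  define R where "R u = fps_nth 1 k - (\<Sum>i=1..k. fps_nth (A u) i * fps_nth (B u) (k - i))" for u
  have R: "R t = fps_nth (A t) 0 * fps_nth (B t) k"
    using rec[OF \<open>t \<in> S\<close>] nz[OF \<open>t \<in> S\<close>] by (simp add: R_def field_simps)
  have dR: "(R has_vector_derivative - T) (at t)"
    unfolding R_def using has_vector_derivative_diff[OF has_vector_derivative_const dsum] by simp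
  have "((\<lambda>u. inverse (fps_nth (A u) 0)) has_vector_derivative
      c * fps_nth (fps_deriv (A t)) 0 * (- inverse (fps_nth (A t) 0 ^ 2))) (at t)"
    using field_vector_diff_chain_at[OF dA[of 0]
        DERIV_inverse[OF nz[OF \<open>t \<in> S\<close>], folded numeral_2_eq_2]]
    by (simp add: o_def power_inverse)
  from has_vector_derivative_mult[OF dR this]
  have "((\<lambda>u. R u * inverse (fps_nth (A u) 0)) has_vector_derivative
      c * fps_nth (fps_deriv (B t)) k) (at t)"
    by (rule has_vector_derivative_eq_rhs)
      (use nz[OF \<open>t \<in> S\<close>] in \<open>simp add: T R field_simps power2_eq_square del: fps_deriv_nth\<close>)
  then have "((\<lambda>u. fps_nth (B u) k) has_vector_derivative c * fps_nth (fps_deriv (B t)) k) (at t)"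
    by (rule has_vector_derivative_transform_within_open[OF _ \<open>open S\<close> \<open>t \<in> S\<close>])
      (simp add: rec R_def divide_inverse)
  then show ?case by (simp add: B_def mult.assoc)
qed

section \<open>The Laplace integral as a differential operator\<close>

text \<open>
  Each \<open>- \<i> \<partial>\<^sub>t\<close> replaces \<open>B\<^sub>j\<close> by \<open>(j + 1) B\<^sub>j\<^sub>+\<^sub>1\<close>, so \<open>j\<close> of them produce \<open>j! B\<^sub>j\<close>; the rest is the
  binomial theorem, by Pascal's rule. Derivatives are local, so the shape of \<open>g\<close> matters only for \<open>t\<close>
  in the open set \<open>S\<close>; for \<open>B\<^sub>0 = 1 / \<F>\<omega>\<close> this avoids the zeros of \<open>\<F>\<omega>\<close>.
\<close>

lemma mixed_op_power:
  fixes B :: "real \<Rightarrow> complex fps"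
  assumes "open S"
    and B: "\<And>m t. m < N \<Longrightarrow> t \<in> S \<Longrightarrow>
      ((\<lambda>t. fps_nth (B t) m) has_vector_derivative \<i> * of_nat (m + 1) * fps_nth (B t) (m + 1)) (at t)"
    and g: "\<And>t u. t \<in> S \<Longrightarrow> g t u = poly P (complex_of_real u) * fps_nth (B t) 0"
    and "k \<le> N" "t \<in> S"
  shows "(mixed_op r ^^ k) g t u =
    (\<Sum>j\<le>k. of_nat (k choose j) * fact j * of_real r ^ (k - j) * fps_nth (B t) j *
      poly ((pderiv ^^ j) P) (of_real u))"
  using \<open>k \<le> N\<close> \<open>t \<in> S\<close>
proof (induction k arbitrary: t u)
  case 0
  then show ?case using g by simp
next
  case (Suc k)
  define a where "a j = complex_of_nat (k choose j) * fact j * of_real r ^ (k - j)" for j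
  let ?P = "\<lambda>j u. poly ((pderiv ^^ j) P) (complex_of_real u)"
  have IH: "(mixed_op r ^^ k) g t' u' = (\<Sum>j\<le>k. a j * fps_nth (B t') j * ?P j u')"
    if "t' \<in> S" for t' u'
    unfolding a_def using Suc that by simp
  have du: "vector_derivative (\<lambda>u'. (mixed_op r ^^ k) g t' u') (at u) =
      (\<Sum>j\<le>k. a j * fps_nth (B t') j * ?P (Suc j) u)" if "t' \<in> S" for t'
    unfolding IH[OF that]
    by (intro vector_derivative_at has_vector_derivative_sum has_vector_derivative_mult_right
        has_vector_derivative_real_field) (simp add: poly_DERIV)
  have "((\<lambda>t'. \<Sum>j\<le>k. a j * fps_nth (B t') j * ?P (Suc j) u) has_vector_derivative
      (\<Sum>j\<le>k. a j * (\<i> * of_nat (j + 1) * fps_nth (B t) (j + 1)) * ?P (Suc j) u)) (at t)"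
    using Suc.prems
    by (intro has_vector_derivative_sum has_vector_derivative_mult_left
        has_vector_derivative_mult_right B) auto
  then have dt: "vector_derivative (\<lambda>t'. vector_derivative (\<lambda>u'. (mixed_op r ^^ k) g t' u') (at u)) (at t) =
      (\<Sum>j\<le>k. a j * (\<i> * of_nat (j + 1) * fps_nth (B t) (j + 1)) * ?P (Suc j) u)"
    using Suc.prems du
    by (intro vector_derivative_at)
      (rule has_vector_derivative_transform_within_open[OF _ \<open>open S\<close>], auto)
  define b where "b j = fps_nth (B t) j * ?P j u" for j
  define c where "c j = (complex_of_nat (k choose j)) * fact j * of_real r ^ (Suc k - j)" for j
  have "(mixed_op r ^^ Suc k) g t u = of_real r * (\<Sum>j\<le>k. a j * b j) +
      (\<Sum>j\<le>k. a j * of_nat (Suc j) * b (Suc j))"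
    by (simp add: mixed_op_def[of r "(mixed_op r ^^ k) g"] dt IH[OF Suc.prems(2)] b_def
        sum_distrib_left mult.assoc mult.left_commute)
      (simp flip: mult.assoc sum_negf)
  also have "of_real r * (\<Sum>j\<le>k. a j * b j) = (\<Sum>j\<le>Suc k. c j * b j)"
    by (simp add: sum_distrib_left a_def c_def Suc_diff_le mult_ac)
  also have "\<dots> = c 0 * b 0 + (\<Sum>j\<le>k. c (Suc j) * b (Suc j))"
    by (rule sum.atMost_Suc_shift)
  also have "c 0 * b 0 + (\<Sum>j\<le>k. c (Suc j) * b (Suc j)) + (\<Sum>j\<le>k. a j * of_nat (Suc j) * b (Suc j)) =
      c 0 * b 0 + (\<Sum>j\<le>k. (c (Suc j) + a j * of_nat (Suc j)) * b (Suc j))"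
    by (simp add: sum.distrib distrib_right del: of_nat_Suc)
  also have "\<dots> = (\<Sum>j\<le>Suc k. of_nat (Suc k choose j) * fact j * of_real r ^ (Suc k - j) * b j)"
    unfolding sum.atMost_Suc_shift
    by (intro arg_cong2[where f="(+)"] sum.cong refl)
      (simp_all add: a_def c_def algebra_simps)
  finally show ?case by (simp add: b_def mult.assoc)
qed

lemma has_bochner_integral_power_exp:
  "has_bochner_integral lborel (\<lambda>r. indicator {0..} r *\<^sub>R complex_of_real (r ^ k * exp (- r))) (fact k)"
proof -
  have "has_bochner_integral lborel (\<lambda>r::real. r ^ k * exp (- r) * indicator {0..} r) (fact k)"
  proof (rule has_bochner_integral_nn_integral)
    have "(\<integral>\<^sup>+r. ennreal (r ^ k * exp (- r) * indicator {0..} r) \<partial>lborel) =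
        (\<integral>\<^sup>+r. ennreal (r ^ k * exp (- r)) * indicator {0..} r \<partial>lborel)"
      by (intro nn_integral_cong) (auto split: split_indicator)
    then show "(\<integral>\<^sup>+r. ennreal (r ^ k * exp (- r) * indicator {0..} r) \<partial>lborel) = ennreal (fact k)"
      by (simp add: nn_intergal_power_times_exp_Ici)
  qed (auto split: split_indicator)
  from has_bochner_integral_of_real[OF this, where 'a=complex] show ?thesis
    by (simp add: scaleR_conv_of_real mult_ac)
qed

text \<open>
  The integral over \<open>r\<close> contributes \<open>(n - 1 - j)!\<close>, which cancels the coefficient
  \<open>(n - 1 choose j) j! / (n - 1)!\<close>.
\<close>

lemma laplace_average:
  assumes "n \<ge> 1"
  shows "(LINT r:{0..}|lborel. complex_of_real (exp (- r)) *
    ((\<Sum>j\<le>n - 1. of_nat (n - 1 choose j) * fact j * of_real r ^ (n - 1 - j) * b j) / fact (n - 1))) =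
    (\<Sum>j<n. b j)"
proof -
  have coef: "of_nat (n - 1 choose j) * fact j * b j / fact (n - 1) * fact (n - 1 - j) = b j"
    if "j \<in> {..n - 1}" for j
  proof -
    have "complex_of_nat (fact j * fact (n - 1 - j) * (n - 1 choose j)) = fact (n - 1)"
      using that by (subst binomial_fact_lemma) auto
    then show ?thesis by (simp add: field_simps)
  qed
  have "has_bochner_integral lborel (\<lambda>r. \<Sum>j\<le>n - 1.
      (of_nat (n - 1 choose j) * fact j * b j / fact (n - 1)) *
      (indicator {0..} r *\<^sub>R complex_of_real (r ^ (n - 1 - j) * exp (- r))))
    (\<Sum>j\<le>n - 1. (of_nat (n - 1 choose j) * fact j * b j / fact (n - 1)) * fact (n - 1 - j))"
    by (intro has_bochner_integral_sum has_bochner_integral_mult_right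
        has_bochner_integral_power_exp)
  then have "has_bochner_integral lborel (\<lambda>r. \<Sum>j\<le>n - 1.
      (of_nat (n - 1 choose j) * fact j * b j / fact (n - 1)) *
      (indicator {0..} r *\<^sub>R complex_of_real (r ^ (n - 1 - j) * exp (- r))))
    (\<Sum>j\<le>n - 1. b j)"
    by (simp only: coef cong: sum.cong)
  moreover have "{..n - 1} = {..<n}" using assms by auto
  ultimately show ?thesis
    unfolding set_lebesgue_integral_def
    by (intro has_bochner_integral_integral_eq)
      (simp add: sum_distrib_left sum_distrib_right sum_divide_distrib scaleR_conv_of_real mult_ac)
qed

text \<open>
  The coefficient of order \<open>0\<close> of the inverse moment series is \<open>1 / \<F>\<omega>\<close>, so the function under the
  operator is \<open>P(u)\<close> times the bottom of the tower of derivatives provided by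
  \<open>fps_inverse_tower\<close>.
\<close>

lemma laplace_op_poly:
  assumes "n \<ge> 1" and \<omega>: "\<omega> \<in> L1F n" and nz: "fourier \<omega> 0 \<noteq> 0"
    and P: "\<And>u. complex_of_real (P u) = poly Q (complex_of_real u)"
  shows "laplace_op n \<omega> P y' = poly (diff_op n (inverse (moment_fps \<omega> 0)) Q) (complex_of_real y')"
proof -
  define B where "B t = inverse (moment_fps \<omega> t)" for t
  let ?g = "\<lambda>t u. complex_of_real (P u) * (1 / fourier \<omega> t)"
  have g: "?g t u = poly Q (complex_of_real u) * fps_nth (B t) 0" for t u
    by (simp add: P B_def fps_inverse_def moment_fps_0 divide_inverse)
  have "(mixed_op r ^^ (n - 1)) ?g 0 y' =
      (\<Sum>j\<le>n - 1. of_nat (n - 1 choose j) * fact j * of_real r ^ (n - 1 - j) *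
        (fps_nth (B 0) j * poly ((pderiv ^^ j) Q) (of_real y')))" for r
  \<comment> \<open>For \<open>n = 1\<close> no derivative occurs. For \<open>n \<ge> 2\<close> the first moment exists, so \<open>\<F>\<omega>\<close> is differentiable,
    and therefore nonzero on a neighbourhood of \<open>0\<close>.\<close>
  proof (cases "n = 1")
    case True
    then show ?thesis using g[of y' 0] by (simp add: mult.commute)
  next
    case False
    define S where "S = {t. fourier \<omega> t \<noteq> 0}"
    have "continuous_on UNIV (fourier \<omega>)"
    proof (rule continuous_at_imp_continuous_on, rule ballI)
      fix t
      have "((\<lambda>t. fps_nth (moment_fps \<omega> t) 0) has_vector_derivative
          \<i> * of_nat (0 + 1) * fps_nth (moment_fps \<omega> t) (0 + 1)) (at t)"
        using False \<open>n \<ge> 1\<close> by (intro has_vector_derivative_moment_fps[OF \<omega>]) simp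
      then show "isCont (fourier \<omega>) t"
        unfolding moment_fps_0 by (rule has_vector_derivative_continuous)
    qed
    then have "open S"
      unfolding S_def by (intro open_Collect_neq continuous_on_const)
    have B: "((\<lambda>t. fps_nth (B t) m) has_vector_derivative
        \<i> * of_nat (m + 1) * fps_nth (B t) (m + 1)) (at t)" if "m < n - 1" "t \<in> S" for m t
      unfolding B_def using that
      by (intro fps_inverse_tower[OF \<open>open S\<close>, of _ "n - 1"] has_vector_derivative_moment_fps[OF \<omega>])
        (auto simp: S_def moment_fps_0)
    show ?thesis
      using nz by (subst mixed_op_power[OF \<open>open S\<close> B g]) (auto simp: S_def mult.assoc)
  qed
  then have "laplace_op n \<omega> P y' = (\<Sum>j<n. fps_nth (B 0) j * poly ((pderiv ^^ j) Q) (of_real y'))"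
    unfolding laplace_op_def by (simp only: laplace_average[OF \<open>n \<ge> 1\<close>])
  then show ?thesis by (simp add: diff_op_def B_def poly_sum)
qed

section \<open>Bi-orthonormal functions of the sum\<close>

text \<open>
  The determinant in \<open>p_D\<close> has the argument \<open>y\<close> in its rows, the one required for a description by
  bi-orthonormal functions has it in its columns; the two are transposes of each other.
\<close>

lemma p_D_proportional:
  assumes "inj_on x {1..n}" "fourier \<omega> 0 \<noteq> 0"
  shows "\<exists>C. C \<noteq> 0 \<and>
    (\<forall>y. p_D n \<omega> x y = C * (vandermonde n y * det_1n n (\<lambda>b c. \<omega> (y c - x b))))"
proof -
  have tr: "det_1n n (\<lambda>b c. F c b) = det_1n n F" for F
  proof -
    have "Matrix.mat n n (\<lambda>(a, b). F (Suc b) (Suc a)) =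
        transpose_mat (Matrix.mat n n (\<lambda>(a, b). F (Suc a) (Suc b)))"
      by (rule eq_matI) auto
    then show ?thesis unfolding det_1n_def by (simp add: det_transpose[where n=n])
  qed
  have "x c - x b \<noteq> 0" if "c \<in> {1..n}" "b \<in> {1..<c}" for b c
    using that assms(1) by (auto dest!: inj_onD)
  then have "vandermonde n x \<noteq> 0" by (simp add: vandermonde_def)
  moreover have "Re (fourier \<omega> 0) \<noteq> 0"
  proof -
    have "fourier \<omega> 0 = complex_of_real (LINT x|lborel. \<omega> x)"
      by (simp add: fourier_def)
    then show ?thesis using assms(2) by (simp add: complex_eq_iff)
  qed
  ultimately show ?thesis
    by (intro exI[of _ "1 / (fact n * Re (fourier \<omega> 0) ^ n) / vandermonde n x"])
      (simp add: p_D_def tr[of "\<lambda>a b. \<omega> (_ a - x b)"])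
qed

theorem mainTheorem2:
  fixes n :: nat and \<omega> :: "real \<Rightarrow> real" and x :: "nat \<Rightarrow> real"
    and M :: "'a measure" and X1 :: "'a \<Rightarrow> complex Matrix.mat" and X2 :: "complex Matrix.mat"
  assumes "n \<ge> 1"
    and "\<omega> \<in> L1F n"
    and "polya_ensemble n \<omega> M X1"
    and "inj_on x {1..n}"
    and "X2 \<in> Herm n" and "has_eigenvalues n X2 x"
    and "unordered_eigenvalue_density n M (\<lambda>m. X1 m + X2) (p_D n \<omega> x)"
  shows "described_by n (p_D n \<omega> x) (\<lambda>b y. \<omega> (y - x b)) (p_fun n \<omega> x) (q_fun \<omega> x) \<and>
    (\<forall>y' y. biorth_kernel n (p_fun n \<omega> x) (q_fun \<omega> x) y' y =
       laplace_op n \<omega>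
         (\<lambda>u. \<Sum>j\<in>{1..n}. \<omega> (y - x j) * (\<Prod>l\<in>{1..n} - {j}. (x l - u) / (x l - x j))) y')"
proof -
  have nz: "fourier \<omega> 0 \<noteq> 0"
  proof
    assume "fourier \<omega> 0 = 0"
    \<comment> \<open>The normalising factor of \<open>p_D\<close> is then \<open>1 / 0 = 0\<close>, as \<open>n > 0\<close>.\<close>
    then have "p_D n \<omega> x = (\<lambda>_. 0)"
      using \<open>n \<ge> 1\<close> by (intro ext) (simp add: p_D_def power_0_left)
    moreover have "X1 m + X2 \<in> Herm n" if "m \<in> space M" for m
    proof -
      obtain f where f: "distributed M (lebesgue_herm n) X1 f"
        using assms(3) by (auto simp: polya_ensemble_def)
      have "X1 m \<in> Herm n"
        using measurable_space[OF distributed_measurable[OF f] that] by (simp add: space_lebesgue_herm)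
      then show ?thesis using assms(5) by (rule Herm_add)
    qed
    moreover have "prob_space M" using assms(3) by (simp add: polya_ensemble_def)
    ultimately show False
      using assms(7) not_unordered_eigenvalue_density_zero[of M "\<lambda>m. X1 m + X2" n] by auto
  qed
  let ?A = "moment_fps \<omega> 0"
  define R where "R j = diff_op n (inverse ?A) (lagrange_poly n x (j + 1))" for j
  have A0: "fps_nth ?A 0 \<noteq> 0" using nz by (simp add: moment_fps_0)
  have p: "p_fun n \<omega> x j y = poly (R j) (complex_of_real y)" for j y
    unfolding p_fun_def R_def
    by (rule laplace_op_poly[OF assms(1,2) nz]) (simp only: poly_lagrange_poly)
  have degL: "Polynomial.degree (lagrange_poly n x (j + 1)) < n" if "j < n" for j
    using that by (intro degree_lagrange_poly) simp
  have deg: "Polynomial.degree (R j) < n" if "j < n" for j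
    unfolding R_def using degree_diff_op degL[OF that] by (rule order_le_less_trans)
  have reindex: "(\<Sum>j\<in>{1..n}. f j) = (\<Sum>j<n. f (j + 1))" for f :: "nat \<Rightarrow> 'b :: comm_monoid_add"
    by (rule sum.reindex_bij_witness[of _ "\<lambda>j. j + 1" "\<lambda>j. j - 1"]) auto

  have "has_bochner_integral lborel (\<lambda>y. p_fun n \<omega> x l y * q_fun \<omega> x m y) (if l = m then 1 else 0)"
    if "l < n" "m < n" for l m
  proof -
    have "diff_op n ?A (R l) = lagrange_poly n x (l + 1)"
      unfolding R_def diff_op_mult[OF degL[OF \<open>l < n\<close>]] inverse_mult_eq_1'[OF A0]
      by (rule diff_op_one[OF \<open>n \<ge> 1\<close>])
    then have "poly (diff_op n ?A (R l)) (complex_of_real (x (m + 1))) = (if l = m then 1 else 0)"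
      using poly_lagrange_poly_node[OF assms(4), of "l + 1" "m + 1"] that by auto
    with has_bochner_integral_poly_shift[OF assms(2) deg[OF \<open>l < n\<close>], of "x (m + 1)"]
    show ?thesis by (simp add: p q_fun_def)
  qed
  moreover have "fun_span n (p_fun n \<omega> x) = fun_span n (\<lambda>j y. complex_of_real (y ^ j))"
  proof (rule fun_span_of_poly_basis[OF deg p])
    fix W :: "complex poly" assume W: "Polynomial.degree W < n"
    let ?Q = "diff_op n ?A W"
    have "W = diff_op n (inverse ?A) ?Q"
      unfolding diff_op_mult[OF W] inverse_mult_eq_1[OF A0]
      by (rule diff_op_one[OF \<open>n \<ge> 1\<close>, symmetric])
    also have "?Q = (\<Sum>j\<in>{1..n}. Polynomial.smult (poly ?Q (complex_of_real (x j))) (lagrange_poly n x j))"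
      by (rule lagrange_interpolation[OF assms(4) order_le_less_trans[OF degree_diff_op W]])
    also have "diff_op n (inverse ?A) \<dots> =
        (\<Sum>j<n. Polynomial.smult (poly ?Q (complex_of_real (x (j + 1)))) (R j))"
      unfolding diff_op_sum reindex R_def ..
    finally show "\<exists>c. W = (\<Sum>j<n. Polynomial.smult (c j) (R j))"
      by (intro exI[of _ "\<lambda>j. poly ?Q (complex_of_real (x (j + 1)))"])
  qed
  ultimately have "described_by n (p_D n \<omega> x) (\<lambda>b y. \<omega> (y - x b)) (p_fun n \<omega> x) (q_fun \<omega> x)"
    using p_D_proportional[OF assms(4) nz] by (simp add: described_by_def q_fun_def[abs_def])

  moreover have "biorth_kernel n (p_fun n \<omega> x) (q_fun \<omega> x) y' y = laplace_op n \<omega>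
      (\<lambda>u. \<Sum>j\<in>{1..n}. \<omega> (y - x j) * (\<Prod>l\<in>{1..n} - {j}. (x l - u) / (x l - x j))) y'" for y' y
  proof -
    let ?Q = "\<Sum>j\<in>{1..n}. Polynomial.smult (complex_of_real (\<omega> (y - x j))) (lagrange_poly n x j)"
    have "complex_of_real (\<Sum>j\<in>{1..n}. \<omega> (y - x j) * (\<Prod>l\<in>{1..n} - {j}. (x l - u) / (x l - x j))) =
        poly ?Q (complex_of_real u)" for u
      by (simp only: poly_sum poly_smult poly_lagrange_poly of_real_sum of_real_mult)
    then have "laplace_op n \<omega>
        (\<lambda>u. \<Sum>j\<in>{1..n}. \<omega> (y - x j) * (\<Prod>l\<in>{1..n} - {j}. (x l - u) / (x l - x j))) y' =
        poly (diff_op n (inverse ?A) ?Q) (complex_of_real y')"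
      by (rule laplace_op_poly[OF assms(1,2) nz])
    also have "diff_op n (inverse ?A) ?Q =
        (\<Sum>j<n. Polynomial.smult (complex_of_real (\<omega> (y - x (j + 1)))) (R j))"
      unfolding diff_op_sum reindex R_def ..
    finally show ?thesis
      by (simp add: biorth_kernel_def p q_fun_def poly_sum mult.commute)
  qed
  ultimately show ?thesis by blast
qed

end
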